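(* Let $p$ be a prime and $n,k$ positive integers. The following are equivalent: (i) $S(n,k)$ is a minimum zero case, i.e. $\nu_p(S(n,k)) = (\sigma_p(k)-\sigma_p(n))/(p-1)$; (ii) $B_{n-k}^{(-k)}(x)$ has maximum pole, i.e. $\nu_p(B_{n-k}^{(-k)}) = -\sigma_p(n-k)/(p-1)$; (iii) $r=(n-k)/(p-1)$ is a nonnegative integer and $p \nmid \binom{-(n+1)}{r}$, i.e. $p\nmid \binom{n+r}{r}$. Furthermore, in the minimum zero case, with $r=(n-k)/(p-1)$, \[ \epsilon_p(S(n,k)) \equiv (-1)^r\, \epsilon_p(n!/k!)\, \binom{n+r}{r} \pmod p. \]
   Context: $S(n,k)$ is the Stirling number of the second kind. $\nu_p$ is the $p$-adic valuation on $\mathbb{Q}$, $\sigma_p(m)$ the base-$p$ digit sum of $m\ge 0$, and for nonzero rational $x$, $\epsilon_p(x)=p^{-\nu_p(x)}x$ is its unit part; congruences mod $p$ between $p$-adic units (rationals with numerator and denominator prime to $p$) mean their difference has positive $p$-adic valuation. For $m\in\mathbb{N}$ and $l\in\mathbb{Z}$, the higher order Bernoulli polynomials are defined by $\left(\frac{t}{e^t-1}\right)^l e^{tx}=\sum_{m\ge 0} B_m^{(l)}(x)\frac{t^m}{m!}$, and $B_m^{(l)}=B_m^{(l)}(0)$. *)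

theory Defs
  imports
    "HOL-Computational_Algebra.Computational_Algebra"
    "HOL-Combinatorics.Stirling"
    "HOL-Library.Extended_Real"
begin

(* Integer-valued order at p, meaningful for x \<noteq> 0 only; at x = 0 it is a junk value. *)
definition padic_ord :: "nat \<Rightarrow> rat \<Rightarrow> int" where
  "padic_ord p x =
     (case quotient_of x of (a, b) \<Rightarrow>
        int (multiplicity (int p) a) - int (multiplicity (int p) b))"

(* The valuation takes values in the extended reals so that its value at 0 is \<infinity> and so that
   it can be compared with quotients by p - 1 that need not be integers. *)
definition padic_val :: "nat \<Rightarrow> rat \<Rightarrow> ereal" where
  "padic_val p x = (if x = 0 then \<infinity> else ereal (of_int (padic_ord p x)))"

definition padic_unit_part :: "nat \<Rightarrow> rat \<Rightarrow> rat" where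
  "padic_unit_part p x = of_nat p powi (- padic_ord p x) * x"

definition padic_unit :: "nat \<Rightarrow> rat \<Rightarrow> bool" where
  "padic_unit p x \<longleftrightarrow>
     (case quotient_of x of (a, b) \<Rightarrow> coprime a (int p) \<and> coprime b (int p))"

(* Congruence mod p is a relation between p-adic units only. *)
definition padic_unit_cong :: "nat \<Rightarrow> rat \<Rightarrow> rat \<Rightarrow> bool" where
  "padic_unit_cong p x y \<longleftrightarrow>
     padic_unit p x \<and> padic_unit p y \<and> padic_val p (x - y) > 0"

(* This is gchoose on int, written out because the sort constraint in force for gchoose rejects
   int here (and would silently coerce the upper argument to real); the division is exact. *)
definition int_binomial :: "int \<Rightarrow> nat \<Rightarrow> int" where
  "int_binomial a r = (\<Prod>i=0..<r. a - int i) div fact r"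

lemma of_int_int_binomial: "of_int (int_binomial a r) = (of_int a :: rat) gchoose r"
  unfolding int_binomial_def of_int_gbinomial[symmetric] by (simp add: gbinomial_prod_rev)

(* For p \<ge> 2 the base-p digits of m at positions i > m vanish, since then p ^ i > m. *)
definition digit_sum :: "nat \<Rightarrow> nat \<Rightarrow> nat" where
  "digit_sum p m = (\<Sum>i\<le>m. (m div p ^ i) mod p)"

(* bernoulli_higher l m x is B_m^{(l)}(x).  Numerator and denominator of t / (e^t - 1) both have
   subdegree 1; division of power series cancels the common factor t, giving a power series with
   constant coefficient 1, so its integer powers are again power series. *)
definition bernoulli_higher :: "int \<Rightarrow> nat \<Rightarrow> rat \<Rightarrow> rat" where
  "bernoulli_higher l m x =
     fact m * fps_nth (((fps_X / (fps_exp 1 - 1)) powi l) * fps_exp x) m"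

definition minimum_zero_case :: "nat \<Rightarrow> nat \<Rightarrow> nat \<Rightarrow> bool" where
  "minimum_zero_case p n k \<longleftrightarrow>
     padic_val p (of_nat (Stirling n k)) =
       ereal ((real (digit_sum p k) - real (digit_sum p n)) / (real p - 1))"

definition has_maximum_pole :: "nat \<Rightarrow> int \<Rightarrow> nat \<Rightarrow> bool" where
  "has_maximum_pole p l m \<longleftrightarrow>
     padic_val p (bernoulli_higher l m 0) = ereal (- real (digit_sum p m) / (real p - 1))"

end

theory Submission
  imports Defs "HOL-Number_Theory.Residues"
begin

text \<open>
  With \<open>m = n - k\<close> and \<open>a\<close> the coefficient of \<open>t^m\<close> in \<open>((exp t - 1) / t)^k\<close> one has
  \<open>S(n,k) = (n! / k!) a\<close> and \<open>B_m^(-k) = m! a\<close>, so by Legendre's formula both extremal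
  conditions say \<open>(p - 1) \<nu>(a) = - m\<close>, the least possible value. Let \<open>E = (exp t - 1) / t\<close> and
  call two series congruent if the coefficients \<open>c\<close> of \<open>t^j\<close> in their difference satisfy
  \<open>(p - 1) \<nu>(c) > - j\<close>. The binomial theorem and Fermat's little theorem give the congruence of
  \<open>E + t^(p-1) E^p / p\<close> and \<open>1\<close>. Multiplying by \<open>E^(k-1)\<close> yields modulo \<open>p\<close> a recurrence in \<open>k\<close>
  and \<open>r\<close> for \<open>p^r\<close> times the coefficient of \<open>t^(r(p-1))\<close> in \<open>E^k\<close>. By Pascal's rule
  \<open>(-1)^r (k + r p choose r)\<close> solves the same recurrence, and \<open>k + r p = n + r\<close>.
\<close>

section \<open>Valuations of rationals\<close>

text \<open>Cross-multiplying with the reduced fraction shows that any representation may be used,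
  not only the one in lowest terms. This permits computing over a common denominator.\<close>

lemma padic_ord_divide:
  assumes "prime p" "a \<noteq> 0" "b \<noteq> 0"
  shows "padic_ord p (of_int a / of_int b) =
    int (multiplicity (int p) a) - int (multiplicity (int p) b)"
proof -
  obtain c d where q: "quotient_of (of_int a / of_int b) = (c, d)" by force
  have d: "d > 0" using quotient_of_denom_pos[OF q] .
  have eq: "(of_int a / of_int b :: rat) = of_int c / of_int d" using quotient_of_div[OF q] .
  with d assms have "c \<noteq> 0" by auto
  from eq d assms have "(of_int (a * d) :: rat) = of_int (c * b)" by (simp add: field_simps)
  hence "a * d = c * b" by (simp only: of_int_eq_iff)
  hence "multiplicity (int p) (a * d) = multiplicity (int p) (c * b)" by simp
  hence "multiplicity (int p) a + multiplicity (int p) d =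
      multiplicity (int p) c + multiplicity (int p) b"
    using assms d \<open>c \<noteq> 0\<close> by (subst (asm) (1 2) prime_elem_multiplicity_mult_distrib) auto
  thus ?thesis unfolding padic_ord_def q by simp
qed

lemma rat_common_denominator:
  fixes x y :: rat
  obtains a b d where "d \<noteq> 0" "x = of_int a / of_int d" "y = of_int b / of_int d"
proof -
  obtain a1 d1 where q1: "quotient_of x = (a1, d1)" by force
  obtain a2 d2 where q2: "quotient_of y = (a2, d2)" by force
  have "d1 > 0" "d2 > 0" using quotient_of_denom_pos q1 q2 by auto
  moreover have "x = of_int a1 / of_int d1" "y = of_int a2 / of_int d2"
    using quotient_of_div q1 q2 by auto
  ultimately show ?thesis
    by (intro that[of "d1 * d2" "a1 * d2" "a2 * d1"]) auto
qed

lemma padic_ord_mult: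
  assumes "prime p" "x \<noteq> 0" "y \<noteq> 0"
  shows "padic_ord p (x * y) = padic_ord p x + padic_ord p y"
proof -
  obtain a b d where *: "d \<noteq> 0" "x = of_int a / of_int d" "y = of_int b / of_int d"
    by (rule rat_common_denominator)
  with assms have ab: "a \<noteq> 0" "b \<noteq> 0" by auto
  have "x * y = of_int (a * b) / of_int (d * d)" using * by simp
  hence "padic_ord p (x * y) =
      int (multiplicity (int p) (a * b)) - int (multiplicity (int p) (d * d))"
    using padic_ord_divide[of p "a * b" "d * d"] assms(1) ab * by simp
  also have "\<dots> = padic_ord p x + padic_ord p y"
    using * ab assms(1) by (simp add: padic_ord_divide prime_elem_multiplicity_mult_distrib)
  finally show ?thesis .
qed

text \<open>Over a common denominator the ultrametric inequality reduces to divisibility of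
  \<open>a + b\<close> by the smaller of two powers of \<open>p\<close>. The sum has to be nonzero
  because \<open>padic_ord p 0\<close> is 0, not infinity.\<close>

lemma padic_ord_add_ge:
  assumes "prime p" "x \<noteq> 0" "y \<noteq> 0" "x + y \<noteq> 0"
  shows "min (padic_ord p x) (padic_ord p y) \<le> padic_ord p (x + y)"
proof -
  obtain a b d where *: "d \<noteq> 0" "x = of_int a / of_int d" "y = of_int b / of_int d"
    by (rule rat_common_denominator)
  with assms have ab: "a \<noteq> 0" "b \<noteq> 0" by auto
  have xy: "x + y = of_int (a + b) / of_int d" using * by (simp add: add_divide_distrib)
  with assms have ab': "a + b \<noteq> 0" by auto
  let ?m = "min (multiplicity (int p) a) (multiplicity (int p) b)"
  have "int p ^ ?m dvd a + b" by (intro dvd_add multiplicity_dvd') auto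
  hence "?m \<le> multiplicity (int p) (a + b)"
    using ab' assms(1) by (intro multiplicity_geI) (auto dest: prime_gt_1_nat)
  thus ?thesis unfolding xy using * ab assms(1) padic_ord_divide[OF assms(1) ab' \<open>d \<noteq> 0\<close>]
    by (simp add: padic_ord_divide min_def split: if_splits)
qed

lemma padic_ord_of_int:
  "padic_ord p (of_int a) = int (multiplicity (int p) a)"
  by (simp add: padic_ord_def)

lemma padic_ord_1 [simp]: "padic_ord p 1 = 0"
  using padic_ord_of_int[of p 1] by simp

lemma padic_ord_uminus [simp]: "padic_ord p (- x) = padic_ord p x"
  by (simp add: padic_ord_def rat_uminus_code split: prod.splits)

lemma padic_ord_inverse:
  assumes "prime p" "x \<noteq> 0"
  shows "padic_ord p (inverse x) = - padic_ord p x"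
  using padic_ord_mult[of p x "inverse x"] assms by simp

lemma padic_ord_self: "prime p \<Longrightarrow> padic_ord p (of_nat p) = 1"
  using padic_ord_of_int[of p "int p"] prime_gt_1_nat[of p] by (simp add: multiplicity_self)

lemma padic_ord_self_power: "prime p \<Longrightarrow> padic_ord p (of_nat p ^ r) = int r"
  by (induction r) (simp_all add: padic_ord_mult padic_ord_self prime_gt_0_nat)

lemma padic_ord_self_powi: "prime p \<Longrightarrow> padic_ord p (of_nat p powi z) = z"
  by (cases z rule: int_cases4)
     (simp_all add: power_int_minus padic_ord_inverse padic_ord_self_power prime_gt_0_nat)

text \<open>In lowest terms \<open>p\<close> cannot divide both numerator and denominator, so the
  difference of their multiplicities vanishes only if both multiplicities do.\<close>

lemma padic_unit_iff:
  assumes "prime p"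
  shows "padic_unit p x \<longleftrightarrow> x \<noteq> 0 \<and> padic_ord p x = 0"
proof -
  obtain a b where q: "quotient_of x = (a, b)" by force
  have b: "b > 0" using quotient_of_denom_pos[OF q] .
  have cop: "coprime a b" using quotient_of_coprime[OF q] .
  have x: "x = of_int a / of_int b" using quotient_of_div[OF q] .
  have pr: "prime (int p)" using assms by simp
  have copr: "coprime c (int p) \<longleftrightarrow> \<not> int p dvd c" for c
    using pr by (metis coprime_commute prime_imp_coprime coprime_absorb_left not_prime_unit)
  have "multiplicity (int p) c = 0 \<longleftrightarrow> \<not> int p dvd c" if "c \<noteq> 0" for c
    using pr that by (intro prime_elem_multiplicity_eq_zero_iff) auto
  moreover have "\<not> (int p dvd a \<and> int p dvd b)"
    using cop pr by (meson coprime_common_divisor not_prime_unit)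
  moreover have "int p dvd 0" by simp
  moreover have "x = 0 \<longleftrightarrow> a = 0" using b x by simp
  moreover have "padic_ord p x = int (multiplicity (int p) a) - int (multiplicity (int p) b)"
    unfolding padic_ord_def q by simp
  moreover have "padic_unit p x \<longleftrightarrow> \<not> int p dvd a \<and> \<not> int p dvd b"
    unfolding padic_unit_def q by (simp add: copr)
  ultimately show ?thesis using b
    by (metis diff_self int_ops(1) less_irrefl of_nat_eq_iff right_minus_eq)
qed

section \<open>Legendre's formula\<close>

lemma digit_sum_eq:
  assumes "p \<ge> 2"
  shows "digit_sum p m = m mod p + digit_sum p (m div p)"
proof -
  \<comment> \<open>The summation range in \<open>digit_sum\<close> depends on the argument. Padding
    it with zero digits lets the sums for \<open>m\<close> and \<open>m div p\<close> be compared
    after an index shift.\<close>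
  have ext: "(\<Sum>i\<le>N. (m div p ^ i) mod p) = digit_sum p m" if "m \<le> N" for m N
  proof -
    have "m div p ^ i = 0" if "i > m" for i
    proof -
      have "i < p ^ i" using assms by (intro power_gt_expt) auto
      thus ?thesis using that by (intro div_less) auto
    qed
    thus ?thesis unfolding digit_sum_def using that by (intro sum.mono_neutral_right) auto
  qed
  have "digit_sum p m = (\<Sum>i\<le>Suc m. (m div p ^ i) mod p)" by (rule ext[symmetric]) simp
  also have "\<dots> = m mod p + (\<Sum>i\<le>m. (m div p ^ Suc i) mod p)"
    by (subst sum.atMost_Suc_shift) simp
  also have "(\<Sum>i\<le>m. (m div p ^ Suc i) mod p) = (\<Sum>i\<le>m. ((m div p) div p ^ i) mod p)"
    by (simp add: div_mult2_eq)
  also have "\<dots> = digit_sum p (m div p)" by (rule ext) simp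
  finally show ?thesis .
qed

lemma digit_sum_0 [simp]: "digit_sum p 0 = 0"
  by (simp add: digit_sum_def)

lemma digit_sum_pos:
  assumes "p \<ge> 2" "m > 0"
  shows "digit_sum p m > 0"
  using assms(2)
proof (induction m rule: less_induct)
  case (less m)
  show ?case
  proof (cases "m div p = 0")
    case True
    hence "m < p" using assms(1) by (simp add: div_eq_0_iff)
    thus ?thesis using digit_sum_eq[OF assms(1), of m] less.prems by simp
  next
    case False
    hence "digit_sum p (m div p) > 0" using less.prems assms(1) by (intro less.IH) auto
    thus ?thesis using digit_sum_eq[OF assms(1), of m] by simp
  qed
qed

text \<open>Adding 1 to \<open>n\<close> turns its v trailing digits \<open>p - 1\<close> into 0 and
  raises the next digit by 1, where v is the multiplicity of \<open>p\<close> in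
  \<open>Suc n\<close>. The induction removes one trailing digit at a time.\<close>

lemma multiplicity_Suc_digit_sum:
  assumes "prime p"
  shows "(p - 1) * multiplicity (int p) (int (Suc n)) + digit_sum p (Suc n) = Suc (digit_sum p n)"
proof (induction n rule: less_induct)
  case (less n)
  have p: "p \<ge> 2" using assms prime_ge_2_nat by blast
  show ?case
  proof (cases "p dvd Suc n")
    case False
    have "Suc n mod p = Suc (n mod p)" "Suc n div p = n div p"
      using False by (auto simp: mod_Suc div_Suc dvd_eq_mod_eq_0)
    thus ?thesis using False digit_sum_eq[OF p, of n] digit_sum_eq[OF p, of "Suc n"]
      by (simp add: not_dvd_imp_multiplicity_0 del: of_nat_Suc)
  next
    case True
    then obtain q' where q': "Suc n = p * q'" by blast
    then obtain q where q: "Suc n = p * Suc q" by (cases q') auto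
    have n: "n = p * q + (p - 1)" using q p by simp
    have "q < n" unfolding n using p by (cases p) auto
    note IH = less.IH[OF this]
    have "n mod p = p - 1" "n div p = q" unfolding n using p
      by (simp_all only: mod_mult_self4 div_mult_self4) auto
    hence 1: "digit_sum p n = p - 1 + digit_sum p q" using digit_sum_eq[OF p, of n] by simp
    have 2: "digit_sum p (Suc n) = digit_sum p (Suc q)"
      unfolding q using digit_sum_eq[OF p, of "p * Suc q"] p by simp
    have 3: "multiplicity (int p) (int (Suc n)) = Suc (multiplicity (int p) (int (Suc q)))"
      unfolding q of_nat_mult using p by (intro multiplicity_times_same) auto
    show ?thesis using IH p unfolding 1 2 3 mult_Suc_right by linarith
  qed
qed

text \<open>Legendre's formula, obtained by telescoping the change of the digit sum from each number
  to its successor.\<close>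

lemma padic_ord_fact:
  assumes "prime p"
  shows "(int p - 1) * padic_ord p (fact n) = int n - int (digit_sum p n)"
proof (induction n)
  case (Suc n)
  have p: "p \<ge> 2" using assms prime_ge_2_nat by blast
  have "padic_ord p (of_nat (Suc n)) = int (multiplicity (int p) (int (Suc n)))"
    using padic_ord_of_int[of p "int (Suc n)"] by (simp only: of_int_of_nat_eq)
  moreover have "int (p - 1) * int (multiplicity (int p) (int (Suc n))) + int (digit_sum p (Suc n)) =
      1 + int (digit_sum p n)"
    using multiplicity_Suc_digit_sum[OF assms, of n] by (metis of_nat_Suc of_nat_add of_nat_mult)
  moreover have "padic_ord p (fact (Suc n)) = padic_ord p (of_nat (Suc n)) + padic_ord p (fact n)"
    unfolding fact_Suc using assms by (intro padic_ord_mult) (auto simp del: of_nat_Suc)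
  ultimately show ?case using Suc p by (simp add: algebra_simps of_nat_diff)
qed simp

section \<open>Weighted power series\<close>

(* Encodes v / (p - 1) <= nu_p(x) without leaving the integers. *)
definition padic_ge :: "nat \<Rightarrow> int \<Rightarrow> rat \<Rightarrow> bool" where
  "padic_ge p v x \<longleftrightarrow> x = 0 \<or> v \<le> (int p - 1) * padic_ord p x"

lemma padic_ge_0 [simp]: "padic_ge p v 0"
  by (simp add: padic_ge_def)

lemma padic_ge_mono: "padic_ge p v x \<Longrightarrow> w \<le> v \<Longrightarrow> padic_ge p w x"
  by (auto simp: padic_ge_def)

lemma padic_ge_mult:
  assumes "prime p" "padic_ge p v x" "padic_ge p w y"
  shows "padic_ge p (v + w) (x * y)"
proof (cases "x = 0 \<or> y = 0")
  case False
  thus ?thesis using assms by (simp add: padic_ge_def padic_ord_mult distrib_left)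
qed auto

lemma padic_ge_add:
  assumes "prime p" "padic_ge p v x" "padic_ge p v y"
  shows "padic_ge p v (x + y)"
proof (cases "x = 0 \<or> y = 0 \<or> x + y = 0")
  case False
  have p: "int p - 1 \<ge> 0" using prime_gt_0_nat[OF assms(1)] by simp
  have "min (padic_ord p x) (padic_ord p y) \<le> padic_ord p (x + y)"
    using False assms(1) by (intro padic_ord_add_ge) auto
  hence "(int p - 1) * min (padic_ord p x) (padic_ord p y) \<le> (int p - 1) * padic_ord p (x + y)"
    using p by (rule mult_left_mono)
  moreover have "v \<le> (int p - 1) * min (padic_ord p x) (padic_ord p y)"
    using False assms by (auto simp: padic_ge_def min_def)
  ultimately show ?thesis by (simp add: padic_ge_def)
qed (use assms in auto)

lemma padic_ge_uminus [simp]: "padic_ge p v (- x) \<longleftrightarrow> padic_ge p v x"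
  by (simp add: padic_ge_def)

lemma padic_ge_diff:
  assumes "prime p" "padic_ge p v x" "padic_ge p v y"
  shows "padic_ge p v (x - y)"
  using padic_ge_add[of p v x "- y"] assms by simp

lemma padic_ge_sum:
  assumes "prime p" "\<And>i. i \<in> A \<Longrightarrow> padic_ge p v (f i)"
  shows "padic_ge p v (sum f A)"
  using assms(2) by (induction A rule: infinite_finite_induct) (auto intro: padic_ge_add[OF assms(1)])

lemma padic_ge_of_int: "prime p \<Longrightarrow> padic_ge p 0 (of_int a)"
  using prime_gt_0_nat[of p] by (simp add: padic_ge_def padic_ord_of_int)

lemma padic_ge_of_int_dvd:
  assumes "prime p" "int p dvd a"
  shows "padic_ge p (int p - 1) (of_int a)"
proof -
  obtain b where "a = int p * b" using assms by blast
  moreover have "padic_ge p (int p - 1 + 0) (of_nat p * of_int b)"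
    using assms(1)
    by (intro padic_ge_mult padic_ge_of_int) (auto simp: padic_ge_def padic_ord_self)
  ultimately show ?thesis by simp
qed

lemma padic_ge_self_power: "prime p \<Longrightarrow> padic_ge p (int r * (int p - 1)) (of_nat p ^ r)"
  by (simp add: padic_ge_def padic_ord_self_power)

text \<open>After rescaling t by a (p-1)-st root of \<open>p\<close>, this says that all
  coefficients have valuation at least c/(p-1). Thus c = 0 is integrality, and c = 1 on a difference
  is the congruence used below.\<close>

definition fps_ge :: "nat \<Rightarrow> int \<Rightarrow> rat fps \<Rightarrow> bool" where
  "fps_ge p c f \<longleftrightarrow> (\<forall>j. padic_ge p (c - int j) (f $ j))"

lemma fps_ge_mult:
  assumes "prime p" "fps_ge p c f" "fps_ge p d g"
  shows "fps_ge p (c + d) (f * g)"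
  unfolding fps_ge_def
proof
  fix j
  have "padic_ge p (c + d - int j) (f $ i * g $ (j - i))" if "i \<le> j" for i
  proof -
    have "padic_ge p ((c - int i) + (d - int (j - i))) (f $ i * g $ (j - i))"
      using assms by (intro padic_ge_mult) (auto simp: fps_ge_def)
    moreover have "(c - int i) + (d - int (j - i)) = c + d - int j" using that by simp
    ultimately show ?thesis by metis
  qed
  thus "padic_ge p (c + d - int j) ((f * g) $ j)"
    unfolding fps_mult_nth by (intro padic_ge_sum assms(1)) auto
qed

lemma fps_ge_power:
  assumes "prime p" "fps_ge p 0 f"
  shows "fps_ge p 0 (f ^ k)"
proof (induction k)
  case 0
  have "padic_ge p 0 1" by (simp add: padic_ge_def)
  thus ?case by (auto simp: fps_ge_def)
next
  case (Suc k)
  show ?case using fps_ge_mult[OF assms Suc] by simp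
qed

section \<open>The series (exp t - 1) / t\<close>

text \<open>The shift divides by t, as exp t - 1 has no constant term, and makes the coefficients
  immediate.\<close>

definition exp_quot :: "rat fps" where
  "exp_quot = fps_shift 1 (fps_exp 1 - 1)"

lemma exp_quot_nth: "exp_quot $ j = 1 / fact (Suc j)"
  by (simp add: exp_quot_def del: fact_Suc)

lemma fps_X_mult_exp_quot: "fps_X * exp_quot = fps_exp 1 - 1"
  by (rule fps_ext) (auto simp: exp_quot_def)

lemma exp_quot_power_nth: "(exp_quot ^ k) $ j = ((fps_exp 1 - 1) ^ k) $ (k + j)"
  unfolding fps_X_mult_exp_quot[symmetric] power_mult_distrib by (simp add: fps_X_power_mult_nth)

lemma exp_quot_power_nth_0: "(exp_quot ^ k) $ 0 = 1"
  by (simp add: fps_nth_power_0 exp_quot_nth)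

text \<open>For f = exp t - 1 one has f' = f + 1, so the derivative of f^(k+1) is (k+1)(f^(k+1) +
  f^k). On coefficients this is the recurrence of the Stirling numbers.\<close>

lemma Stirling_egf:
  "of_nat (Stirling n k) * fact k = fact n * ((fps_exp 1 - 1 :: rat fps) ^ k) $ n"
proof (induction n k rule: Stirling.induct)
  case (4 n k)
  let ?f = "fps_exp 1 - 1 :: rat fps"
  have "fps_deriv (?f ^ Suc k) = of_nat (Suc k) * (?f ^ Suc k + ?f ^ k)"
    unfolding fps_deriv_power' by (simp add: algebra_simps)
  hence "fps_deriv (?f ^ Suc k) $ n = (of_nat (Suc k) * (?f ^ Suc k + ?f ^ k)) $ n" by (rule arg_cong)
  hence "of_nat (Suc n) * (?f ^ Suc k) $ Suc n =
      of_nat (Suc k) * ((?f ^ Suc k) $ n + (?f ^ k) $ n)"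
    by (simp only: fps_deriv_nth fps_of_nat[symmetric] fps_mult_left_const_nth fps_add_nth Suc_eq_plus1)
  hence "fact (Suc n) * (?f ^ Suc k) $ Suc n =
      of_nat (Suc k) * (fact n * (?f ^ Suc k) $ n + fact n * (?f ^ k) $ n)"
    unfolding fact_Suc by (simp only: algebra_simps)
  thus ?case unfolding 4[symmetric] by (simp add: algebra_simps)
qed (auto simp: fps_nth_power_0)

lemma Stirling_eq_exp_quot:
  "of_nat (Stirling (k + m) k) = fact (k + m) / fact k * (exp_quot ^ k) $ m"
  using Stirling_egf[of "k + m" k] by (simp add: exp_quot_power_nth field_simps)

text \<open>Cancelling t turns t / (exp t - 1) into the inverse of \<open>exp_quot\<close>, so its
  power with exponent -k is \<open>exp_quot ^ k\<close>.\<close>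

lemma bernoulli_higher_eq_exp_quot:
  "bernoulli_higher (- int k) m 0 = fact m * (exp_quot ^ k) $ m"
proof -
  have "exp_quot $ 0 \<noteq> 0" by (simp add: exp_quot_nth)
  hence "fps_X / (fps_exp 1 - 1) = inverse exp_quot"
    using div_mult_mult1[of "fps_X :: rat fps" 1 exp_quot]
    by (simp add: fps_divide_unit fps_X_mult_exp_quot)
  thus ?thesis unfolding bernoulli_higher_def
    using \<open>exp_quot $ 0 \<noteq> 0\<close> by (cases "k = 0") (simp_all add: power_int_def)
qed


text \<open>By Legendre, the order of 1/(j+1)! times p - 1 is the digit sum of j+1 minus (j+1). This
  is at least -j because the digit sum is at least 1.\<close>

lemma fps_ge_exp_quot:
  assumes "prime p"
  shows "fps_ge p 0 exp_quot"
  unfolding fps_ge_def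
proof
  fix j
  have "digit_sum p (Suc j) > 0" using assms prime_ge_2_nat by (intro digit_sum_pos) auto
  thus "padic_ge p (0 - int j) (exp_quot $ j)"
    using padic_ord_fact[OF assms, of "Suc j"] padic_ord_inverse[OF assms, of "fact (Suc j)"]
    by (simp add: exp_quot_nth padic_ge_def inverse_eq_divide del: fact_Suc)
qed

section \<open>The functional congruence, from the binomial theorem and Fermat's little
  theorem\<close>

lemma exp_minus_one_power_nth:
  "fact n * ((fps_exp 1 - 1 :: rat fps) ^ k) $ n =
    of_int (\<Sum>i\<le>k. int (k choose i) * (-1) ^ (k - i) * int i ^ n)"
proof -
  have "(fps_exp 1 - 1 :: rat fps) ^ k =
      (\<Sum>i\<le>k. fps_const (of_nat (k choose i) * (-1) ^ (k - i)) * fps_exp (of_nat i))"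
    using binomial_ring[of "fps_exp 1 :: rat fps" "-1" k]
    by (simp add: fps_exp_power_mult mult_ac fps_of_nat
        flip: fps_const_mult fps_const_power fps_const_neg)
  hence "((fps_exp 1 - 1 :: rat fps) ^ k) $ n =
      (\<Sum>i\<le>k. of_nat (k choose i) * (-1) ^ (k - i) * of_nat i ^ n / fact n)"
    by (simp add: fps_sum_nth)
  thus ?thesis by (simp add: sum_distrib_left)
qed

text \<open>The identity i (p choose i) = p (p-1 choose i-1) extracts the factor \<open>p\<close>.
  If p - 1 divides \<open>N\<close>, Fermat replaces the powers of 1, ..., p-1 by 1, and what
  remains modulo \<open>p\<close> is (1-1)^(p-1) without its last term 1, that is, -1.\<close>

lemma alternating_power_sum_prime:
  fixes p N :: nat
  assumes "prime p" "N \<ge> 1"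
  defines "W \<equiv> \<Sum>i<p. int ((p - 1) choose i) * (-1) ^ (p - 1 - i) * int (Suc i) ^ N"
  shows "(\<Sum>i\<le>p. int (p choose i) * (-1) ^ (p - i) * int i ^ Suc N) = int p * W"
    and "(p - 1) dvd N \<Longrightarrow> int p dvd 1 + W"
proof -
  obtain q where q: "p = Suc q" using prime_gt_0_nat[OF assms(1)] by (cases p) auto
  have "q > 0" using q prime_gt_1_nat[OF assms(1)] by simp
  have "(\<Sum>i\<le>p. int (p choose i) * (-1) ^ (p - i) * int i ^ Suc N) =
      (\<Sum>i\<le>q. int (Suc q choose Suc i) * (-1) ^ (q - i) * int (Suc i) ^ Suc N)"
    unfolding q by (subst sum.atMost_Suc_shift) simp
  also have "\<dots> = (\<Sum>i\<le>q. int (Suc q) * (int (q choose i) * (-1) ^ (q - i) * int (Suc i) ^ N))"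
  proof (rule sum.cong)
    fix i
    have *: "int (Suc q choose Suc i) * int (Suc i) = int (Suc q) * int (q choose i)"
      using Suc_times_binomial[of i q] by (metis mult.commute of_nat_mult)
    have "int (Suc q choose Suc i) * (-1) ^ (q - i) * int (Suc i) ^ Suc N =
        (int (Suc q choose Suc i) * int (Suc i)) * ((-1) ^ (q - i) * int (Suc i) ^ N)"
      by (simp only: power_Suc mult_ac)
    thus "int (Suc q choose Suc i) * (-1) ^ (q - i) * int (Suc i) ^ Suc N =
        int (Suc q) * (int (q choose i) * (-1) ^ (q - i) * int (Suc i) ^ N)"
      unfolding * by (simp only: mult_ac)
  qed simp
  finally show "(\<Sum>i\<le>p. int (p choose i) * (-1) ^ (p - i) * int i ^ Suc N) = int p * W"
    unfolding W_def q by (simp add: sum_distrib_left lessThan_Suc_atMost del: of_nat_Suc)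
  assume "(p - 1) dvd N"
  then obtain c where c: "N = q * c" using q by auto
  have fermat: "[int (Suc i) ^ N = 1] (mod int p)" if "i < q" for i
  proof -
    have "\<not> p dvd Suc i" using that q by (auto dest: dvd_imp_le)
    hence "[Suc i ^ q = 1] (mod p)" using fermat_theorem[OF assms(1), of "Suc i"] q by simp
    hence "[(Suc i ^ q) ^ c = 1 ^ c] (mod p)" by (rule cong_pow)
    hence "[Suc i ^ N = 1] (mod p)" by (simp add: c power_mult)
    thus ?thesis by (metis cong_int_iff of_nat_1 of_nat_power)
  qed
  \<comment> \<open>The index i = q is split off because its base \<open>Suc q\<close> is
    \<open>p\<close>, where Fermat does not apply; its term vanishes modulo \<open>p\<close> as N >
    0.\<close>
  have "W = int p ^ N + (\<Sum>i<q. int (q choose i) * (-1) ^ (q - i) * int (Suc i) ^ N)"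
    unfolding W_def q by simp
  also have "[\<dots> = 0 + (\<Sum>i<q. int (q choose i) * (-1) ^ (q - i) * 1)] (mod int p)"
    using assms(2) fermat
    by (intro cong_add cong_sum cong_mult) (auto simp: cong_0_iff dvd_power simp del: of_nat_Suc)
  also have "0 + (\<Sum>i<q. int (q choose i) * (-1) ^ (q - i) * 1) =
      (\<Sum>i\<le>q. int (q choose i) * (-1) ^ (q - i)) - 1"
    by (simp add: lessThan_Suc_atMost[symmetric])
  also have "(\<Sum>i\<le>q. int (q choose i) * (-1) ^ (q - i)) = (1 + (-1)) ^ q"
    unfolding binomial_ring by simp
  also have "\<dots> = 0" using \<open>q > 0\<close> by simp
  finally have "[1 + W = 1 + (0 - 1)] (mod int p)" by (intro cong_add cong_refl)
  thus "int p dvd 1 + W" by (simp add: cong_0_iff)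
qed

(* Modulo p and after rescaling t by a (p-1)-st root of p, this says
   that exp t - 1 is the compositional inverse of u + u^p. *)
lemma exp_quot_functional_congruence:
  assumes "prime p"
  shows "fps_ge p 1 (exp_quot + fps_const (1 / of_nat p) * (fps_X ^ (p - 1) * exp_quot ^ p) - 1)"
  unfolding fps_ge_def
proof
  fix j
  let ?f = "exp_quot + fps_const (1 / of_nat p) * (fps_X ^ (p - 1) * exp_quot ^ p) - 1"
  have p: "p \<ge> 2" using assms prime_ge_2_nat by blast
  show "padic_ge p (1 - int j) (?f $ j)"
  proof (cases "j = 0")
    case True
    thus ?thesis using p by (simp add: exp_quot_nth fps_X_power_mult_nth)
  next
    case False
    let ?W = "\<Sum>i<p. int ((p - 1) choose i) * (-1) ^ (p - 1 - i) * int (Suc i) ^ j"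
    have "fps_X * (fps_X ^ (p - 1) * exp_quot ^ p) = (fps_exp 1 - 1) ^ p"
      using p unfolding fps_X_mult_exp_quot[symmetric] power_mult_distrib
      by (simp add: mult.assoc[symmetric] power_Suc[symmetric] del: power_Suc)
    hence "(fps_X * (fps_X ^ (p - 1) * exp_quot ^ p)) $ Suc j = ((fps_exp 1 - 1) ^ p) $ Suc j"
      by (simp only:)
    hence "(fps_X ^ (p - 1) * exp_quot ^ p) $ j = ((fps_exp 1 - 1) ^ p) $ Suc j"
      by (simp only: fps_X_mult_nth) simp
    also have "\<dots> = of_int (int p * ?W) / fact (Suc j)"
    proof -
      have "(\<Sum>i\<le>p. int (p choose i) * (-1) ^ (p - i) * int i ^ Suc j) = int p * ?W"
        using alternating_power_sum_prime(1)[OF assms, of j] False by simp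
      with exp_minus_one_power_nth[of "Suc j" p]
      have "fact (Suc j) * ((fps_exp 1 - 1) ^ p) $ Suc j = (of_int (int p * ?W) :: rat)"
        by (simp only:)
      thus ?thesis by (simp only: eq_divide_eq fact_nonzero mult.commute) simp
    qed
    \<comment> \<open>The factor 1/p cancels the \<open>p\<close> extracted from the alternating
      sum, so both summands share the denominator (j+1)!.\<close>
    finally have "?f $ j = 1 / fact (Suc j) * of_int (1 + ?W)"
      using p False by (simp add: exp_quot_nth add_divide_distrib del: fact_Suc)
    moreover have "padic_ge p (1 - int j) (1 / fact (Suc j) * of_int (1 + ?W))"
    proof -
      have ord: "(int p - 1) * padic_ord p (1 / fact (Suc j)) =
          int (digit_sum p (Suc j)) - int (Suc j)"
        using padic_ord_fact[OF assms, of "Suc j"] padic_ord_inverse[OF assms, of "fact (Suc j)"]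
        by (simp add: inverse_eq_divide del: fact_Suc)
      hence A: "padic_ge p (int (digit_sum p (Suc j)) - int (Suc j)) (1 / fact (Suc j))"
        unfolding padic_ge_def by simp
      show ?thesis
      \<comment> \<open>The bound -j for 1/(j+1)! has to be improved by 1. A digit sum of at least 2
        does so by itself. If the digit sum is 1, Legendre makes p - 1 divide \<open>j\<close>, and
        then \<open>1 + ?W\<close> contributes a factor \<open>p\<close>.\<close>
      proof (cases "digit_sum p (Suc j) = 1")
        case True
        have "int j = int (p - 1) * (- padic_ord p (1 / fact (Suc j)))"
          using ord p unfolding True by (simp add: of_nat_diff del: fact_Suc)
        hence "int (p - 1) dvd int j" by (rule dvdI)
        hence "int p dvd 1 + ?W"
          using alternating_power_sum_prime(2)[OF assms, of j] False by simp
        from padic_ge_mult[OF assms A padic_ge_of_int_dvd[OF assms this]]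
        show ?thesis by (rule padic_ge_mono) (use True p in simp)
      next
        case False
        have "digit_sum p (Suc j) > 0" using p by (intro digit_sum_pos) auto
        with False have "digit_sum p (Suc j) \<ge> 2" by simp
        thus ?thesis
          by (intro padic_ge_mono[OF padic_ge_mult[OF assms A padic_ge_of_int[OF assms]]]) simp
      qed
    qed
    ultimately show ?thesis by simp
  qed
qed

section \<open>Coefficients of powers of (exp t - 1) / t modulo p\<close>

lemma exp_quot_power_congruence:
  assumes "prime p"
  shows "fps_ge p 1 (exp_quot ^ Suc k + fps_const (1 / of_nat p) *
    (fps_X ^ (p - 1) * exp_quot ^ (k + p)) - exp_quot ^ k)"
proof -
  have "fps_ge p (0 + 1) (exp_quot ^ k *
      (exp_quot + fps_const (1 / of_nat p) * (fps_X ^ (p - 1) * exp_quot ^ p) - 1))"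
    by (intro fps_ge_mult fps_ge_power fps_ge_exp_quot exp_quot_functional_congruence assms)
  thus ?thesis by (simp add: algebra_simps power_add)
qed

(* The recurrence from the functional congruence is Pascal's rule for (k + r p choose r). *)
lemma exp_quot_power_coeff_cong:
  assumes "prime p"
  shows "padic_ge p 1 (of_nat p ^ r * (exp_quot ^ k) $ (r * (p - 1)) -
    (-1) ^ r * of_nat ((k + r * p) choose r))"
proof (induction r arbitrary: k)
  case 0
  show ?case by (simp add: exp_quot_power_nth_0)
next
  case (Suc r)
  have p: "p \<ge> 2" using assms prime_ge_2_nat by blast
  let ?b = "\<lambda>k r. of_nat p ^ r * (exp_quot ^ k) $ (r * (p - 1))"
  let ?c = "\<lambda>k r. (-1) ^ r * of_nat ((k + r * p) choose r) :: rat"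
  show ?case
  \<comment> \<open>The recurrence relates (k+1, r+1) to (k, r+1) and (k+p, r). Hence the outer
    induction on \<open>r\<close> leaves \<open>k\<close> arbitrary and an inner induction on
    \<open>k\<close> is nested in it.\<close>
  proof (induction k)
    case 0
    \<comment> \<open>For k = 0 the series is 1 and its coefficient in positive degree is 0, so the
      binomial coefficient has to be divisible by \<open>p\<close>. Cancelling \<open>Suc r\<close>
      here shows this.\<close>
    have "Suc r * ((Suc r * p) choose Suc r) = (Suc r * p) * ((Suc r * p - 1) choose r)"
      using times_binomial_minus1_eq[of "Suc r" "Suc r * p"] by simp
    hence "(Suc r * p) choose Suc r = p * ((Suc r * p - 1) choose r)"
      by (metis mult.assoc mult_left_cancel nat.distinct(1))
    hence "int p dvd (-1) ^ Suc r * int ((Suc r * p) choose Suc r)" by simp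
    from padic_ge_of_int_dvd[OF assms this] have "padic_ge p 1 (?c 0 (Suc r))"
      using p by (auto intro: padic_ge_mono)
    moreover have "?b 0 (Suc r) = 0" using p by simp
    ultimately show ?case by (metis diff_0 padic_ge_uminus)
  next
    case (Suc k)
    let ?j = "Suc r * (p - 1)"
    let ?f = "exp_quot ^ Suc k + fps_const (1 / of_nat p) *
      (fps_X ^ (p - 1) * exp_quot ^ (k + p)) - exp_quot ^ k"
    have "padic_ge p (1 - int ?j) (?f $ ?j)"
      using exp_quot_power_congruence[OF assms, of k] unfolding fps_ge_def by blast
    \<comment> \<open>The power of \<open>p\<close> exactly offsets the loss of weight in degree
      (r+1)(p-1), leaving weight 1.\<close>
    from padic_ge_mult[OF assms padic_ge_self_power[OF assms, of "Suc r"] this]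
    have "padic_ge p 1 (of_nat p ^ Suc r * (?f $ ?j))"
    proof (rule padic_ge_mono)
      have "int ?j = int (Suc r) * (int p - 1)" using p by (simp only: of_nat_mult of_nat_diff) simp
      thus "1 \<le> int (Suc r) * (int p - 1) + (1 - int ?j)" by linarith
    qed
    also have "of_nat p ^ Suc r * (?f $ ?j) = ?b (Suc k) (Suc r) + ?b (k + p) r - ?b k (Suc r)"
    proof -
      have "?j - (p - 1) = r * (p - 1)" "\<not> ?j < p - 1" by simp_all
      hence "?f $ ?j = (exp_quot ^ Suc k) $ ?j + 1 / of_nat p * (exp_quot ^ (k + p)) $ (r * (p - 1))
          - (exp_quot ^ k) $ ?j"
        by (simp only: fps_sub_nth fps_add_nth fps_mult_left_const_nth fps_X_power_mult_nth if_False)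
      moreover have "of_nat p ^ Suc r * (1 / of_nat p * z) = of_nat p ^ r * z" for z :: rat
        using p by simp
      ultimately show ?thesis by (simp only: distrib_left right_diff_distrib)
    qed
    finally have 1: "padic_ge p 1 (?b (Suc k) (Suc r) + ?b (k + p) r - ?b k (Suc r))" .
    \<comment> \<open>Pascal's rule with upper index k + (r+1)p = (k+p) + rp; the alternating signs
      cancel one of its two terms.\<close>
    have 2: "?c (Suc k) (Suc r) + ?c (k + p) r = ?c k (Suc r)"
      by (simp add: algebra_simps)
    have "padic_ge p 1 ((?b (Suc k) (Suc r) + ?b (k + p) r - ?b k (Suc r))
        - (?b (k + p) r - ?c (k + p) r) + (?b k (Suc r) - ?c k (Suc r)))"
      by (intro padic_ge_add padic_ge_diff assms 1 Suc.IH \<open>\<And>k. padic_ge p 1 (?b k r - ?c k r)\<close>)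
    also have "(?b (Suc k) (Suc r) + ?b (k + p) r - ?b k (Suc r))
        - (?b (k + p) r - ?c (k + p) r) + (?b k (Suc r) - ?c k (Suc r)) =
        ?b (Suc k) (Suc r) - ?c (Suc k) (Suc r)"
      using 2 by (simp only: algebra_simps)
    finally show ?case .
  qed
qed


section \<open>Maximal poles\<close>

text \<open>Weight 1 only bounds the order below by 1/(p-1), but orders are integers, so the order
  is at least 1.\<close>

lemma padic_ge_1_iff_not_unit:
  assumes "prime p" "padic_ge p 0 x"
  shows "padic_ge p 1 x \<longleftrightarrow> \<not> padic_unit p x"
proof (cases "x = 0")
  case True
  thus ?thesis using assms(1) by (simp add: padic_unit_iff)
next
  case False
  have p: "int p - 1 > 0" using prime_gt_1_nat[OF assms(1)] by simp
  hence "1 \<le> (int p - 1) * padic_ord p x \<longleftrightarrow> padic_ord p x > 0"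
    by (metis zero_less_mult_pos int_one_le_iff_zero_less mult_pos_pos)
  moreover have "padic_ord p x \<ge> 0"
    using assms(2) False p by (simp add: padic_ge_def zero_le_mult_iff)
  ultimately show ?thesis using assms(1) False by (auto simp: padic_ge_def padic_unit_iff)
qed

lemma padic_ge_cong:
  assumes "prime p" "padic_ge p v (x - y)"
  shows "padic_ge p v x \<longleftrightarrow> padic_ge p v y"
  using padic_ge_add[OF assms(1) assms(2), of y] padic_ge_diff[OF assms(1) _ assms(2), of x] by auto

lemma padic_unit_of_int_iff:
  assumes "prime p"
  shows "padic_unit p (of_int a) \<longleftrightarrow> \<not> int p dvd a"
proof (cases "a = 0")
  case False
  have "prime_elem (int p)" using assms by simp
  thus ?thesis using False assms
    by (simp add: padic_unit_iff padic_ord_of_int prime_elem_multiplicity_eq_zero_iff)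
qed (use assms in \<open>simp add: padic_unit_iff\<close>)

lemma exp_quot_power_coeff_ge:
  assumes "prime p"
  shows "padic_ge p (- int m) ((exp_quot ^ k) $ m)"
  using fps_ge_power[OF assms fps_ge_exp_quot[OF assms], of k] by (simp add: fps_ge_def)

text \<open>The factor \<open>p ^ r\<close> makes the coefficient p-integral. It is then congruent
  to a signed binomial coefficient, and congruent p-integral numbers are units together.\<close>

lemma exp_quot_power_coeff_unit_iff:
  assumes "prime p"
  shows "padic_unit p (of_nat p ^ r * (exp_quot ^ k) $ (r * (p - 1))) \<longleftrightarrow>
    \<not> p dvd ((k + r * p) choose r)"
proof -
  let ?x = "of_nat p ^ r * (exp_quot ^ k) $ (r * (p - 1))"
  let ?c = "(-1) ^ r * int ((k + r * p) choose r)"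
  have "padic_ge p 0 ?x"
    by (rule padic_ge_mono[OF padic_ge_mult[OF assms padic_ge_self_power[OF assms]
          exp_quot_power_coeff_ge[OF assms]]])
       (use prime_gt_0_nat[OF assms] in \<open>simp add: of_nat_diff\<close>)
  moreover have "padic_ge p 1 (?x - of_int ?c)"
    using exp_quot_power_coeff_cong[OF assms, of r k] by simp
  ultimately have "padic_unit p ?x \<longleftrightarrow> padic_unit p (of_int ?c)"
    using padic_ge_cong[OF assms] padic_ge_1_iff_not_unit[OF assms] padic_ge_of_int[OF assms]
    by blast
  also have "\<dots> \<longleftrightarrow> \<not> p dvd ((k + r * p) choose r)"
    unfolding padic_unit_of_int_iff[OF assms] by (cases "even r") auto
  finally show ?thesis .
qed

text \<open>Since orders are integers, attaining the bound -m forces p - 1 to divide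
  \<open>m\<close>. With r = m/(p-1), attaining it means that \<open>p ^ r\<close> times the
  coefficient is a unit.\<close>

lemma exp_quot_power_coeff_pole_iff:
  assumes "prime p"
  defines "a \<equiv> \<lambda>k m. (exp_quot ^ k) $ m"
  shows "a k m \<noteq> 0 \<and> (int p - 1) * padic_ord p (a k m) = - int m \<longleftrightarrow>
    (\<exists>r. m = r * (p - 1) \<and> \<not> p dvd ((k + r * p) choose r))"
proof -
  have p: "p \<ge> 2" using assms(1) prime_ge_2_nat by blast
  have unit: "\<not> p dvd ((k + r * p) choose r) \<longleftrightarrow>
      a k m \<noteq> 0 \<and> (int p - 1) * padic_ord p (a k m) = - int m" if "m = r * (p - 1)" for r
  proof -
    have "- int m = (int p - 1) * (- int r)" using that p by (simp add: of_nat_diff)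
    hence "(int p - 1) * padic_ord p (a k m) = - int m \<longleftrightarrow> padic_ord p (a k m) = - int r"
      using p by (simp only: mult_cancel_left) simp
    moreover have "padic_unit p (of_nat p ^ r * a k m) \<longleftrightarrow> a k m \<noteq> 0 \<and> padic_ord p (a k m) = - int r"
      using assms(1) p by (auto simp: padic_unit_iff padic_ord_mult padic_ord_self_power)
    moreover have "padic_unit p (of_nat p ^ r * a k m) \<longleftrightarrow> \<not> p dvd ((k + r * p) choose r)"
      using exp_quot_power_coeff_unit_iff[OF assms(1), of r k] unfolding a_def that .
    ultimately show ?thesis by blast
  qed
  have "\<exists>r. m = r * (p - 1)" if "(int p - 1) * padic_ord p (a k m) = - int m"
  proof -
    have "int m = int (p - 1) * (- padic_ord p (a k m))" using that p by (simp add: of_nat_diff)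
    hence "int (p - 1) dvd int m" by (rule dvdI)
    thus ?thesis by (metis dvd_def int_dvd_int_iff mult.commute)
  qed
  thus ?thesis using unit by blast
qed

section \<open>Translation to Stirling and Bernoulli numbers\<close>

lemma padic_val_eq_iff:
  assumes "prime p"
  shows "padic_val p x = ereal (of_int v / (real p - 1)) \<longleftrightarrow>
    x \<noteq> 0 \<and> (int p - 1) * padic_ord p x = v"
proof -
  have p: "real p - 1 > 0" using prime_gt_1_nat[OF assms] by simp
  have "of_int (padic_ord p x) = of_int v / (real p - 1) \<longleftrightarrow>
      real_of_int ((int p - 1) * padic_ord p x) = of_int v"
    using p by (simp add: field_simps)
  also have "\<dots> \<longleftrightarrow> (int p - 1) * padic_ord p x = v" by (rule of_int_eq_iff)
  finally show ?thesis by (simp add: padic_val_def)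
qed

text \<open>Legendre for (k+m)!/k! supplies exactly the two digit sums in the definition, and after
  cancelling them only -m is left.\<close>

lemma minimum_zero_case_iff:
  assumes "prime p"
  shows "minimum_zero_case p (k + m) k \<longleftrightarrow> (exp_quot ^ k) $ m \<noteq> 0 \<and>
    (int p - 1) * padic_ord p ((exp_quot ^ k) $ m) = - int m"
proof -
  let ?F = "fact (k + m) / fact k :: rat" and ?a = "(exp_quot ^ k) $ m"
  have F: "(int p - 1) * padic_ord p ?F =
      int m - int (digit_sum p (k + m)) + int (digit_sum p k)"
    using padic_ord_fact[OF assms, of "k + m"] padic_ord_fact[OF assms, of k]
      padic_ord_mult[OF assms, of "fact (k + m)" "inverse (fact k)"]
    by (simp add: padic_ord_inverse[OF assms] divide_inverse right_diff_distrib)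
  have "(int p - 1) * padic_ord p (?F * ?a) =
      (int p - 1) * padic_ord p ?F + (int p - 1) * padic_ord p ?a" if "?a \<noteq> 0"
    using that padic_ord_mult[OF assms, of ?F ?a] by (simp add: distrib_left[symmetric])
  thus ?thesis
    using padic_val_eq_iff[OF assms, of "?F * ?a" "int (digit_sum p k) - int (digit_sum p (k + m))"] F
    unfolding minimum_zero_case_def Stirling_eq_exp_quot by (cases "?a = 0") auto
qed

text \<open>The digit sum cancels against Legendre for m!. The resulting condition is the one in
  \<open>minimum_zero_case_iff\<close>, which links the two notions.\<close>

lemma has_maximum_pole_iff:
  assumes "prime p"
  shows "has_maximum_pole p (- int k) m \<longleftrightarrow> (exp_quot ^ k) $ m \<noteq> 0 \<and>
    (int p - 1) * padic_ord p ((exp_quot ^ k) $ m) = - int m"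
proof -
  let ?a = "(exp_quot ^ k) $ m"
  have "(int p - 1) * padic_ord p (fact m * ?a) =
      int m - int (digit_sum p m) + (int p - 1) * padic_ord p ?a" if "?a \<noteq> 0"
    using that padic_ord_fact[OF assms, of m] by (simp add: padic_ord_mult[OF assms] distrib_left)
  thus ?thesis using padic_val_eq_iff[OF assms, of "fact m * ?a" "- int (digit_sum p m)"]
    unfolding has_maximum_pole_def bernoulli_higher_eq_exp_quot by (cases "?a = 0") auto
qed

section \<open>Unit parts and the congruence for Stirling numbers\<close>

lemma padic_unit_part_mult:
  assumes "prime p" "x \<noteq> 0" "y \<noteq> 0"
  shows "padic_unit_part p (x * y) = padic_unit_part p x * padic_unit_part p y"
  using assms prime_gt_0_nat[of p]
  by (simp add: padic_unit_part_def padic_ord_mult power_int_diff power_int_minus field_simps)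

lemma padic_unit_part_unit:
  assumes "prime p" "x \<noteq> 0"
  shows "padic_unit p (padic_unit_part p x)"
  using assms prime_gt_0_nat[of p]
  by (simp add: padic_unit_iff padic_unit_part_def padic_ord_mult padic_ord_self_powi)

lemma padic_unit_mult:
  assumes "prime p" "padic_unit p x" "padic_unit p y"
  shows "padic_unit p (x * y)"
  using assms by (simp add: padic_unit_iff padic_ord_mult)

lemma padic_val_pos_if_ge_1:
  assumes "prime p" "padic_ge p 1 x"
  shows "padic_val p x > 0"
proof (cases "x = 0")
  case False
  have p: "int p - 1 > 0" using prime_gt_1_nat[OF assms(1)] by simp
  have "0 < (int p - 1) * padic_ord p x" using assms(2) False by (simp add: padic_ge_def)
  hence "padic_ord p x > 0" using p by (simp add: zero_less_mult_iff)
  thus ?thesis using False by (simp add: padic_val_def)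
qed (simp add: padic_val_def)

text \<open>The coefficient has order -r, so its unit part is \<open>p ^ r\<close> times itself.
  Multiplying the congruence for it by the unit part of n!/k! preserves weight 1.\<close>

lemma Stirling_unit_part_cong:
  assumes "prime p" "n = k + r * (p - 1)" "\<not> p dvd ((n + r) choose r)"
  shows "padic_unit_cong p (padic_unit_part p (of_nat (Stirling n k)))
    ((-1) ^ r * padic_unit_part p (fact n / fact k) * of_nat ((n + r) choose r))"
proof -
  let ?a = "(exp_quot ^ k) $ (r * (p - 1))" and ?u = "padic_unit_part p (fact n / fact k)"
  let ?c = "(-1) ^ r * of_nat ((n + r) choose r) :: rat"
  have p: "p \<ge> 2" using assms(1) prime_ge_2_nat by blast
  have nr: "n + r = k + r * p" using assms(2) p by (cases p) auto
  have x: "padic_unit p (of_nat p ^ r * ?a)"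
    using exp_quot_power_coeff_unit_iff[OF assms(1)] assms(3) unfolding nr by blast
  hence a: "?a \<noteq> 0" "padic_ord p ?a = - int r"
    using p by (auto simp: padic_unit_iff assms(1) padic_ord_mult padic_ord_self_power)
  have "of_nat (Stirling n k) = fact n / fact k * ?a"
    unfolding assms(2) by (rule Stirling_eq_exp_quot)
  hence S: "padic_unit_part p (of_nat (Stirling n k)) = ?u * (of_nat p ^ r * ?a)"
    using padic_unit_part_mult[OF assms(1) _ a(1), of "fact n / fact k"] a(2)
    unfolding padic_unit_part_def[of p ?a] by simp
  have u: "padic_unit p ?u" using assms(1) by (intro padic_unit_part_unit) auto
  have "padic_unit p (of_int ((-1) ^ r * int ((n + r) choose r)))"
    unfolding padic_unit_of_int_iff[OF assms(1)] using assms(3) by (cases "even r") auto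
  hence c: "padic_unit p ?c" by simp
  have "padic_ge p 0 ?u" using u assms(1) by (simp add: padic_ge_def padic_unit_iff)
  from padic_ge_mult[OF assms(1) this exp_quot_power_coeff_cong[OF assms(1), of r k]]
  have "padic_ge p 1 (?u * (of_nat p ^ r * ?a) - ?u * ?c)"
    unfolding nr by (simp add: right_diff_distrib)
  from padic_val_pos_if_ge_1[OF assms(1) this] padic_unit_mult[OF assms(1) u c]
    padic_unit_mult[OF assms(1) u x]
  have "padic_unit_cong p (?u * (of_nat p ^ r * ?a)) (?u * ?c)"
    by (simp add: padic_unit_cong_def)
  thus ?thesis unfolding S by (simp only: mult_ac)
qed

section \<open>The binomial condition and the theorem\<close>

lemma int_binomial_neg: "int_binomial (- (int n + 1)) r = (-1) ^ r * int ((n + r) choose r)"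
proof -
  have "(of_int (int_binomial (- (int n + 1)) r) :: rat) = (- (of_nat n + 1)) gchoose r"
    by (simp add: of_int_int_binomial)
  also have "\<dots> = (-1) ^ r * (of_nat (n + r) gchoose r)" by (subst gbinomial_minus) simp
  also have "\<dots> = of_int ((-1) ^ r * int ((n + r) choose r))" by (simp add: binomial_gbinomial)
  finally show ?thesis by (simp only: of_int_eq_iff)
qed

text \<open>The right side avoids truncated subtraction of \<open>k\<close> from \<open>n\<close>,
  so for n < k both sides fail.\<close>

lemma of_nat_eq_diff_divide_iff:
  assumes "p \<ge> 2"
  shows "(of_nat r :: rat) = (of_nat n - of_nat k) / (of_nat p - 1) \<longleftrightarrow> n = k + r * (p - 1)"
proof -
  have "(of_nat p - 1 :: rat) = of_nat (p - 1)" using assms by (simp add: of_nat_diff)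
  hence "(of_nat r :: rat) = (of_nat n - of_nat k) / (of_nat p - 1) \<longleftrightarrow>
      (of_nat n :: rat) = of_nat (k + r * (p - 1))"
    using assms by (auto simp: eq_divide_eq simp del: of_nat_diff)
  thus ?thesis by (simp only: of_nat_eq_iff)
qed

lemma minimum_zero_case_iff_binomial:
  assumes "prime p"
  shows "minimum_zero_case p n k \<longleftrightarrow> (\<exists>r. n = k + r * (p - 1) \<and> \<not> p dvd ((n + r) choose r))"
proof (cases "k \<le> n")
  case True
  then obtain m where m: "n = k + m" by (auto simp: le_iff_add)
  have "n + r = k + r * p" if "m = r * (p - 1)" for r
    using prime_gt_0_nat[OF assms] that unfolding m by (cases p) auto
  hence "(n = k + r * (p - 1) \<and> \<not> p dvd ((n + r) choose r)) \<longleftrightarrow>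
      (m = r * (p - 1) \<and> \<not> p dvd ((k + r * p) choose r))" for r
    unfolding m by (metis add_left_cancel add.assoc)
  thus ?thesis
    unfolding m minimum_zero_case_iff[OF assms] exp_quot_power_coeff_pole_iff[OF assms] by simp
next
  case False
  thus ?thesis by (auto simp: minimum_zero_case_def padic_val_def)
qed

theorem theorem2p1:
  fixes p n k :: nat
  assumes "prime p" and "n > 0" and "k > 0"
  shows
    "(minimum_zero_case p n k \<longleftrightarrow> k \<le> n \<and> has_maximum_pole p (- int k) (n - k)) \<and>
     (minimum_zero_case p n k \<longleftrightarrow>
        (\<exists>r::nat. (of_nat r :: rat) = (of_nat n - of_nat k) / (of_nat p - 1) \<and>
           \<not> int p dvd int_binomial (- (int n + 1)) r)) \<and>
     (minimum_zero_case p n k \<longleftrightarrow>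
        (\<exists>r::nat. (of_nat r :: rat) = (of_nat n - of_nat k) / (of_nat p - 1) \<and>
           \<not> p dvd ((n + r) choose r))) \<and>
     (minimum_zero_case p n k \<longrightarrow>
        (\<exists>r::nat. (of_nat r :: rat) = (of_nat n - of_nat k) / (of_nat p - 1) \<and>
           padic_unit_cong p
             (padic_unit_part p (of_nat (Stirling n k)))
             ((- 1) ^ r * padic_unit_part p (fact n / fact k) * of_nat ((n + r) choose r))))"
proof -
  have p: "p \<ge> 2" using assms(1) prime_ge_2_nat by blast
  have "minimum_zero_case p n k \<longleftrightarrow> k \<le> n \<and> has_maximum_pole p (- int k) (n - k)"
  proof (cases "k \<le> n")
    case True
    thus ?thesis
      using minimum_zero_case_iff[OF assms(1), of k "n - k"] has_maximum_pole_iff[OF assms(1)] by simp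
  next
    \<comment> \<open>Here the Stirling number is 0 and has infinite valuation, so the minimum zero
      case fails. The truncated \<open>n - k\<close> would be 0, hence the conjunct
      \<open>k \<le> n\<close>.\<close>
    case False
    thus ?thesis by (simp add: minimum_zero_case_def padic_val_def)
  qed
  moreover have "int p dvd int_binomial (- (int n + 1)) r \<longleftrightarrow> p dvd ((n + r) choose r)" for r
    unfolding int_binomial_neg by (cases "even r") auto
  ultimately show ?thesis
    unfolding of_nat_eq_diff_divide_iff[OF p]
    using minimum_zero_case_iff_binomial[OF assms(1), of n k]
      Stirling_unit_part_cong[OF assms(1), of n k] by blast
qed

end
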